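(* Let $\mathcal X$ be a finite nonempty set. Let $\mathbb L_1$ be the set of all functions $p:\mathcal X\times A\to[0,1]$ (with $\mathcal X^0\subset A\subset\bigcup_{t=0}^\infty\mathcal X^t$ allowed to depend on $p$) such that $(\mathcal X,A,p)$ is a probabilistic language space of the first kind. Let $\mathbb L_2$ be the set of all functions $p:\bigcup_{t=1}^\infty\mathcal X^t\to[0,1]$ such that $(\mathcal X,p)$ is a probabilistic language space of the second kind. Then there is a bijection $\Phi_{12}:\mathbb L_1\to\mathbb L_2$ such that for all $p:\mathcal X\times A\to[0,1]$ in $\mathbb L_1$, $$\Phi_{12}(p)(x,y)=p(y\mid x)\,\Phi_{12}(p)(x)\qquad\text{for all }(y,x)\in\mathcal X\times A,$$ where $\Phi_{12}(p)$ is extended to the empty sequence by the value $1$.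
   Context: $\mathcal X^0=\{(\,)\}$ consists of the empty sequence only. $(x,y)$ denotes the concatenation of finite sequences (an element of $\mathcal X$ is viewed as a sequence of length 1), and $|x|$ is the length of $x$. For $p:\mathcal X\times A\to[0,1]$ the value at $(y,x)$ is written $p(y\mid x)$. A probabilistic language space of the first kind is a triple $(\mathcal X,A,p)$ such that: (1) $\mathcal X$ is a finite nonempty set; (2) $\mathcal X^0\subset A\subset\bigcup_{t=0}^\infty\mathcal X^t$; (3) $p:\mathcal X\times A\to[0,1]$; (4) for all $t\ge1$ and all $x\in\mathcal X^t$, $x\in A\iff p(x_t\mid x_1,\ldots,x_{t-1})\neq0$, where $p(y\mid x)$ is taken to be $0$ when $x\notin A$ (so the condition says: $(x_1,\ldots,x_{t-1})\in A$ and $p(x_t\mid x_1,\ldots,x_{t-1})\ne0$); (5) for all $x\in A$, $\sum_{y\in\mathcal X}p(y\mid x)=1$. A probabilistic language space of the second kind is a couple $(\mathcal X,p)$ such that: (1) $\mathcal X$ is a finite nonempty set; (2) $p:\bigcup_{t=1}^\infty\mathcal X^t\to[0,1]$; (3) $\sum_{x\in\mathcal X}p(x)=1$; (4) for all $x\in\bigcup_{t=1}^\infty\mathcal X^t$, $\sum_{y\in\mathcal X}p(x,y)=p(x)$. *)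

theory Defs
  imports Complex_Main "HOL-Library.FuncSet"
begin

text \<open>
  Finite sequences over \<open>X\<close> are elements of \<open>lists X\<close>; the concatenation \<open>(x, y)\<close> of a
  sequence \<open>x\<close> and a letter \<open>y\<close> is \<open>x @ [y]\<close>.  A function between sets is an element of
  the corresponding \<open>PiE\<close>, so that equality of functions is equality on the domain.
\<close>

text \<open>The value \<open>p(y | x)\<close>, taken to be 0 for \<open>x \<notin> A\<close>.\<close>

definition cond_prob :: "'a list set \<Rightarrow> ('a \<times> 'a list \<Rightarrow> real) \<Rightarrow> 'a \<Rightarrow> 'a list \<Rightarrow> real" where
  "cond_prob A p y x = (if x \<in> A then p (y, x) else 0)"

definition prob_language_space1 ::
    "'a set \<Rightarrow> 'a list set \<Rightarrow> ('a \<times> 'a list \<Rightarrow> real) \<Rightarrow> bool" where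
  "prob_language_space1 X A p \<longleftrightarrow>
     finite X \<and> X \<noteq> {} \<and>
     {[]} \<subseteq> A \<and> A \<subseteq> lists X \<and>
     p \<in> X \<times> A \<rightarrow>\<^sub>E {0..1} \<and>
     (\<forall>x\<in>lists X. x \<noteq> [] \<longrightarrow> (x \<in> A \<longleftrightarrow> cond_prob A p (last x) (butlast x) \<noteq> 0)) \<and>
     (\<forall>x\<in>A. (\<Sum>y\<in>X. cond_prob A p y x) = 1)"

definition prob_language_space2 :: "'a set \<Rightarrow> ('a list \<Rightarrow> real) \<Rightarrow> bool" where
  "prob_language_space2 X p \<longleftrightarrow>
     finite X \<and> X \<noteq> {} \<and>
     p \<in> lists X - {[]} \<rightarrow>\<^sub>E {0..1} \<and>
     (\<Sum>x\<in>X. p [x]) = 1 \<and>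
     (\<forall>x\<in>lists X - {[]}. (\<Sum>y\<in>X. p (x @ [y])) = p x)"

text \<open>
  The domain \<open>X \<times> A\<close> of a function of the first kind varies with the function.  As a
  total HOL function does not record its domain, such a function is represented by the
  pair \<open>(A, p)\<close>; for nonempty \<open>X\<close> the set \<open>A\<close> is determined by the domain \<open>X \<times> A\<close>.
\<close>

definition L1 :: "'a set \<Rightarrow> ('a list set \<times> ('a \<times> 'a list \<Rightarrow> real)) set" where
  "L1 X = {(A, p). prob_language_space1 X A p}"

definition L2 :: "'a set \<Rightarrow> ('a list \<Rightarrow> real) set" where
  "L2 X = {p. prob_language_space2 X p}"

definition extend_empty :: "('a list \<Rightarrow> real) \<Rightarrow> 'a list \<Rightarrow> real" where
  "extend_empty q x = (if x = [] then 1 else q x)"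

end

theory Submission
  imports Defs
begin

text \<open>
  The map multiplies the conditional probabilities along a sequence (chain rule).  Along a
  sequence \<open>x\<close> the product is nonzero exactly when \<open>x \<in> A\<close>, so \<open>A\<close> is recovered as the
  support of the image and \<open>p(y | x)\<close> as the quotient of consecutive values.
\<close>

definition seq_prob :: "'a list set \<Rightarrow> ('a \<times> 'a list \<Rightarrow> real) \<Rightarrow> 'a list \<Rightarrow> real" where
  "seq_prob A p x = (\<Prod>i<length x. cond_prob A p (x ! i) (take i x))"

lemma seq_prob_Nil [simp]: "seq_prob A p [] = 1"
  by (simp add: seq_prob_def)

lemma seq_prob_snoc [simp]: "seq_prob A p (x @ [y]) = cond_prob A p y x * seq_prob A p x"
  by (simp add: seq_prob_def nth_append)

text \<open>The restriction puts the image in the extensional function space of \<open>L2\<close>;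
  the dropped value 1 at \<open>[]\<close> is restored by \<open>extend_empty\<close>.\<close>

definition to_second ::
    "'a set \<Rightarrow> 'a list set \<times> ('a \<times> 'a list \<Rightarrow> real) \<Rightarrow> 'a list \<Rightarrow> real" where
  "to_second X = (\<lambda>(A, p). restrict (seq_prob A p) (lists X - {[]}))"

text \<open>Taking \<open>A\<close> as the support of the extended function puts \<open>[]\<close>
  into \<open>A\<close> and keeps the denominator nonzero on \<open>X \<times> A\<close>.\<close>

definition to_first ::
    "'a set \<Rightarrow> ('a list \<Rightarrow> real) \<Rightarrow> 'a list set \<times> ('a \<times> 'a list \<Rightarrow> real)" where
  "to_first X q =
     (let A = {x \<in> lists X. extend_empty q x \<noteq> 0} in
      (A, \<lambda>(y, x)\<in>X \<times> A. extend_empty q (x @ [y]) / extend_empty q x))"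

lemma extend_empty_to_second:
  assumes "x \<in> lists X"
  shows "extend_empty (to_second X (A, p)) x = seq_prob A p x"
  using assms by (simp add: extend_empty_def to_second_def)

text \<open>The membership condition is recast from \<open>last\<close> and \<open>butlast\<close>
  to the form that \<open>rev_induct\<close> produces.\<close>

lemma prob_language_space1_snoc:
  assumes "prob_language_space1 X A p" "x \<in> lists X" "y \<in> X"
  shows "x @ [y] \<in> A \<longleftrightarrow> cond_prob A p y x \<noteq> 0"
proof -
  have "x @ [y] \<in> lists X" using assms by simp
  then show ?thesis
    using assms(1) unfolding prob_language_space1_def
    by (metis butlast_snoc last_snoc snoc_eq_iff_butlast)
qed

lemma cond_prob_bounds:
  assumes "prob_language_space1 X A p" "y \<in> X"
  shows "0 \<le> cond_prob A p y x" "cond_prob A p y x \<le> 1"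
proof -
  have "p (y, x) \<in> {0..1}" if "x \<in> A"
    using assms that unfolding prob_language_space1_def by (blast dest: PiE_mem)
  then show "0 \<le> cond_prob A p y x" "cond_prob A p y x \<le> 1"
    by (auto simp: cond_prob_def)
qed

lemma seq_prob_bounds:
  assumes "prob_language_space1 X A p" "x \<in> lists X"
  shows "0 \<le> seq_prob A p x" "seq_prob A p x \<le> 1"
  using assms(2)
  by (induction x rule: rev_induct)
     (auto intro!: mult_le_one mult_nonneg_nonneg cond_prob_bounds[OF assms(1)])

text \<open>The last factor decides: \<open>cond_prob\<close> vanishes outside \<open>A\<close>, so
  a nonzero last factor puts the prefix in \<open>A\<close>, where by induction the remaining
  product is nonzero.\<close>

lemma seq_prob_nonzero_iff:
  assumes "prob_language_space1 X A p" "x \<in> lists X"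
  shows "seq_prob A p x \<noteq> 0 \<longleftrightarrow> x \<in> A"
  using assms(2)
proof (induction x rule: rev_induct)
  case Nil
  then show ?case using assms(1) by (simp add: prob_language_space1_def)
next
  case (snoc y x)
  then show ?case
    using prob_language_space1_snoc[OF assms(1), of x y]
    by (auto simp: cond_prob_def split: if_splits)
qed

text \<open>For \<open>x \<in> A\<close> the common factor \<open>seq_prob A p x\<close> leaves a
  sum equal to 1; otherwise that factor is 0 and both sides vanish.\<close>

lemma sum_seq_prob_snoc:
  assumes "prob_language_space1 X A p" "x \<in> lists X"
  shows "(\<Sum>y\<in>X. seq_prob A p (x @ [y])) = seq_prob A p x"
proof (cases "x \<in> A")
  case True
  then have "(\<Sum>y\<in>X. cond_prob A p y x) = 1"
    using assms(1) by (simp add: prob_language_space1_def)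
  then show ?thesis by (simp flip: sum_distrib_right)
next
  case False
  then have "seq_prob A p x = 0" using seq_prob_nonzero_iff[OF assms] by blast
  then show ?thesis by simp
qed

lemma to_second_in_L2:
  assumes "(A, p) \<in> L1 X"
  shows "to_second X (A, p) \<in> L2 X"
proof -
  have sp: "prob_language_space1 X A p" using assms by (simp add: L1_def)
  let ?q = "to_second X (A, p)"
  have q: "?q x = seq_prob A p x" if "x \<in> lists X" "x \<noteq> []" for x
    using that by (simp add: to_second_def)
  have "?q \<in> lists X - {[]} \<rightarrow>\<^sub>E {0..1}"
    by (auto simp: to_second_def intro: seq_prob_bounds[OF sp])
  \<comment> \<open>Normalisation is the marginal identity at the empty sequence, whose product is
    1.\<close>
  moreover have "(\<Sum>y\<in>X. ?q [y]) = 1"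
    using sum_seq_prob_snoc[OF sp, of "[]"] by (simp add: q cong: sum.cong)
  moreover have "(\<Sum>y\<in>X. ?q (x @ [y])) = ?q x" if "x \<in> lists X - {[]}" for x
    using sum_seq_prob_snoc[OF sp, of x] that by (simp add: q cong: sum.cong)
  ultimately show ?thesis
    using sp by (simp add: L2_def prob_language_space2_def prob_language_space1_def)
qed

text \<open>The value 1 at \<open>[]\<close> merges the normalisation and marginal conditions into
  one identity.\<close>

lemma sum_extend_empty_snoc:
  assumes "prob_language_space2 X q" "x \<in> lists X"
  shows "(\<Sum>y\<in>X. extend_empty q (x @ [y])) = extend_empty q x"
  using assms by (cases "x = []") (simp_all add: prob_language_space2_def extend_empty_def)

lemma extend_empty_nonneg:
  assumes "prob_language_space2 X q" "x \<in> lists X"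
  shows "0 \<le> extend_empty q x"
proof (cases "x = []")
  case False
  then have "q x \<in> {0..1}"
    using assms unfolding prob_language_space2_def by (blast dest: PiE_mem)
  then show ?thesis by (simp add: extend_empty_def)
qed (simp add: extend_empty_def)

text \<open>A summand of a finite sum of nonnegative terms is at most the sum. This bounds the
  quotients in \<open>to_first\<close> by 1.\<close>

lemma extend_empty_snoc_le:
  assumes "prob_language_space2 X q" "x \<in> lists X" "y \<in> X"
  shows "extend_empty q (x @ [y]) \<le> extend_empty q x"
proof -
  have "extend_empty q (x @ [y]) \<le> (\<Sum>y\<in>X. extend_empty q (x @ [y]))"
    using assms
    by (intro member_le_sum extend_empty_nonneg[OF assms(1)])
       (auto simp: prob_language_space2_def)
  then show ?thesis using sum_extend_empty_snoc[OF assms(1,2)] by simp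
qed

text \<open>Monotonicity and nonnegativity squeeze the value to 0; hence the support is closed under
  prefixes.\<close>

lemma extend_empty_snoc_eq_0:
  assumes "prob_language_space2 X q" "x \<in> lists X" "y \<in> X" "extend_empty q x = 0"
  shows "extend_empty q (x @ [y]) = 0"
  using extend_empty_snoc_le[OF assms(1-3)] extend_empty_nonneg[OF assms(1), of "x @ [y]"] assms
  by simp

text \<open>Outside \<open>A\<close> both sides are 0, since division by zero yields 0; the formula
  thus covers all of \<open>lists X\<close>.\<close>

lemma cond_prob_to_first:
  assumes "to_first X q = (A, p)" "x \<in> lists X" "y \<in> X"
  shows "cond_prob A p y x = extend_empty q (x @ [y]) / extend_empty q x"
  using assms by (auto simp: to_first_def Let_def cond_prob_def)

lemma to_first_in_L1:
  assumes "q \<in> L2 X"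
  shows "to_first X q \<in> L1 X"
proof -
  have sp: "prob_language_space2 X q" using assms by (simp add: L2_def)
  obtain A p where Ap: "to_first X q = (A, p)" by fastforce
  have A: "A = {x \<in> lists X. extend_empty q x \<noteq> 0}"
    and p: "p = (\<lambda>(y, x)\<in>X \<times> A. extend_empty q (x @ [y]) / extend_empty q x)"
    using Ap by (auto simp: to_first_def Let_def)
  have "extend_empty q (x @ [y]) / extend_empty q x \<in> {0..1}" if "y \<in> X" "x \<in> lists X" for x y
  proof -
    have "0 \<le> extend_empty q x" "0 \<le> extend_empty q (x @ [y])"
      "extend_empty q (x @ [y]) \<le> extend_empty q x"
      using that by (auto intro!: extend_empty_nonneg[OF sp] extend_empty_snoc_le[OF sp])
    then show ?thesis by (auto simp: divide_le_eq_1)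
  qed
  then have "p \<in> X \<times> A \<rightarrow>\<^sub>E {0..1}"
    unfolding p by (simp add: restrict_PiE_iff A Pi_iff split_def del: atLeastAtMost_iff in_lists_conv_set)
  moreover have "x \<in> A \<longleftrightarrow> cond_prob A p (last x) (butlast x) \<noteq> 0"
    if "x \<in> lists X" "x \<noteq> []" for x
  proof -
    obtain z y where x: "x = z @ [y]" using \<open>x \<noteq> []\<close> by (metis append_butlast_last_id)
    have zy: "z \<in> lists X" "y \<in> X" using that x by auto
    \<comment> \<open>The quotient is nonzero iff numerator and denominator both are; by prefix
      closure the numerator alone decides.\<close>
    show ?thesis
      using extend_empty_snoc_eq_0[OF sp zy] cond_prob_to_first[OF Ap zy] zy
      by (auto simp: x A)
  qed
  moreover have "(\<Sum>y\<in>X. cond_prob A p y x) = 1" if "x \<in> A" for x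
  proof -
    have "x \<in> lists X" "extend_empty q x \<noteq> 0" using that by (auto simp: A)
    \<comment> \<open>Over the common nonzero denominator, the numerators sum to that
      denominator.\<close>
    then show ?thesis
      using sum_extend_empty_snoc[OF sp, of x]
      by (simp add: cond_prob_to_first[OF Ap] flip: sum_divide_distrib cong: sum.cong)
  qed
  moreover have "{[]} \<subseteq> A" "A \<subseteq> lists X" by (auto simp: A extend_empty_def)
  ultimately show ?thesis
    using sp by (simp add: Ap L1_def prob_language_space1_def prob_language_space2_def)
qed

lemma to_first_to_second:
  assumes "(A, p) \<in> L1 X"
  shows "to_first X (to_second X (A, p)) = (A, p)"
proof -
  have sp: "prob_language_space1 X A p" using assms by (simp add: L1_def)
  have AX: "A \<subseteq> lists X" and pE: "p \<in> extensional (X \<times> A)"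
    using sp by (auto simp: prob_language_space1_def PiE_def)
  have A: "{x \<in> lists X. extend_empty (to_second X (A, p)) x \<noteq> 0} = A"
    using AX seq_prob_nonzero_iff[OF sp]
    by (simp add: set_eq_iff extend_empty_to_second del: in_lists_conv_set cong: conj_cong) blast
  have "(\<lambda>(y, x)\<in>X \<times> A. extend_empty (to_second X (A, p)) (x @ [y])
      / extend_empty (to_second X (A, p)) x) = p"
  \<comment> \<open>Both functions are \<open>undefined\<close> off \<open>X \<times> A\<close>; on
    it, the nonzero factor \<open>seq_prob A p x\<close> cancels.\<close>
  proof (rule extensionalityI[OF restrict_extensional pE])
    fix yx assume "yx \<in> X \<times> A"
    then obtain y x where yx: "yx = (y, x)" "y \<in> X" "x \<in> A" by blast
    then have "x \<in> lists X" "seq_prob A p x \<noteq> 0"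
      using AX seq_prob_nonzero_iff[OF sp] by blast+
    then show "(\<lambda>(y, x)\<in>X \<times> A. extend_empty (to_second X (A, p)) (x @ [y])
      / extend_empty (to_second X (A, p)) x) yx = p yx"
      using yx by (simp add: extend_empty_to_second cond_prob_def)
  qed
  with A show ?thesis by (simp add: to_first_def Let_def)
qed

lemma to_second_to_first:
  assumes "q \<in> L2 X"
  shows "to_second X (to_first X q) = q"
proof -
  have sp: "prob_language_space2 X q" using assms by (simp add: L2_def)
  obtain A p where Ap: "to_first X q = (A, p)" by fastforce
  \<comment> \<open>The product of quotients telescopes down to the value 1 at \<open>[]\<close>.
    Where a denominator is 0, the longer sequence also has value 0, so the equation
    persists.\<close>
  have eq: "seq_prob A p x = extend_empty q x" if "x \<in> lists X" for x
    using that
  proof (induction x rule: rev_induct)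
    case Nil
    then show ?case by (simp add: extend_empty_def)
  next
    case (snoc y x)
    then have "x \<in> lists X" "y \<in> X" by auto
    with snoc.IH show ?case
      using extend_empty_snoc_eq_0[OF sp, of x y] by (simp add: cond_prob_to_first[OF Ap])
  qed
  have "q \<in> extensional (lists X - {[]})"
    using sp by (auto simp: prob_language_space2_def PiE_def)
  then have "restrict (seq_prob A p) (lists X - {[]}) = q"
    by (intro extensionalityI[OF restrict_extensional]) (auto simp: eq extend_empty_def)
  then show ?thesis by (simp add: Ap to_second_def)
qed

theorem proposition5:
  fixes X :: "'a set"
  assumes "finite X" and "X \<noteq> {}"
  shows "\<exists>\<Phi>. bij_betw \<Phi> (L1 X) (L2 X) \<and>
    (\<forall>(A, p)\<in>L1 X. \<forall>(y, x)\<in>X \<times> A.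
       extend_empty (\<Phi> (A, p)) (x @ [y]) = p (y, x) * extend_empty (\<Phi> (A, p)) x)"
proof (intro exI conjI)
  show "bij_betw (to_second X) (L1 X) (L2 X)"
    by (rule bij_betw_byWitness[where f' = "to_first X"])
       (auto simp: to_first_to_second to_second_to_first intro: to_second_in_L2 to_first_in_L1)
  show "\<forall>(A, p)\<in>L1 X. \<forall>(y, x)\<in>X \<times> A.
      extend_empty (to_second X (A, p)) (x @ [y]) = p (y, x) * extend_empty (to_second X (A, p)) x"
  proof clarify
    fix A p y x
    assume "(A, p) \<in> L1 X" "y \<in> X" "x \<in> A"
    moreover from this have "x \<in> lists X" by (auto simp: L1_def prob_language_space1_def)
    \<comment> \<open>This is the recursion \<open>seq_prob_snoc\<close>, with
      \<open>cond_prob\<close> equal to \<open>p\<close> because \<open>x \<in> A\<close>.\<close>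
    ultimately show "extend_empty (to_second X (A, p)) (x @ [y])
        = p (y, x) * extend_empty (to_second X (A, p)) x"
      by (simp add: extend_empty_to_second cond_prob_def)
  qed
qed

end
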